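(* Let $n \geq 1$ be an integer and let $\mathbb{F}_q$ be a definite finite field (i.e. $q \equiv 3 \pmod 4$). Let $\circledcirc$ be a binary operation on $\mathbf{L}_n^{\mathbb{F}_q^+}$ making $(\mathbf{L}_n^{\mathbb{F}_q^+}, \circledcirc)$ a group with identity element $\mathrm{I}_n$. Define a binary operation $\boxdot$ on $LPM_n^{\mathbb{F}_q}$ as follows: for $A, B \in LPM_n^{\mathbb{F}_q}$, write their unique Cholesky factorizations as $$A = L\,\mathbb{D}_\epsilon L^T \in LPM_n^{\mathbb{F}_q}(\epsilon), \qquad B = K\,\mathbb{D}_{\epsilon'} K^T \in LPM_n^{\mathbb{F}_q}(\epsilon'),$$ with $\epsilon, \epsilon' \in \{\pm1\}^n$ and $L, K \in \mathbf{L}_n^{\mathbb{F}_q^+}$, and set $$A \boxdot B := (L \circledcirc K)(\mathbb{D}_\epsilon \mathbb{D}_{\epsilon'})(L\circledcirc K)^T.$$ Then $(LPM_n^{\mathbb{F}_q}, \boxdot)$ is a group with identity element $\mathrm{I}_n$, and the inverse of $A = L\,\mathbb{D}_\epsilon L^T$ is $L^{\circledcirc -1}\,\mathbb{D}_\epsilon\,(L^{\circledcirc -1})^T$, where $L^{\circledcirc -1}$ is the inverse of $L$ in $(\mathbf{L}_n^{\mathbb{F}_q^+}, \circledcirc)$. Moreover, for every $A \in LPM_n^{\mathbb{F}_q}$, the square $A \boxdot A$ is positive definite.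
   Context: An element of $\mathbb{F}_q^\times$ is positive if it is a nonzero square, and negative otherwise; $\mathbb{F}_q^+$ is the set of positive elements. The quadratic character $\chi$ takes the value $1$ on positive elements, $-1$ on negative elements, and $\chi(0)=0$. In a definite field, $-1$ is negative. A symmetric matrix over $\mathbb{F}_q$ is positive definite if all its leading principal minors are positive. $LPM_n^{\mathbb{F}_q}$ is the set of symmetric matrices in $\mathbb{F}_q^{n\times n}$ all of whose leading principal minors are nonzero. For $\epsilon\in\{\pm1\}^n$, $LPM_n^{\mathbb{F}_q}(\epsilon)$ is the subset of those matrices whose $k\times k$ leading principal minor has quadratic character $\epsilon_k$ for each $k=1,\dots,n$; $LPM_n^{\mathbb{F}_q}$ is the disjoint union of these subsets over all $\epsilon$. $\mathbf{L}_n^{\mathbb{F}_q^+}$ is the set of lower triangular matrices in $\mathbb{F}_q^{n\times n}$ with all diagonal entries positive. $\mathrm{I}_n$ is the $n\times n$ identity matrix. $\mathbb{D}_\epsilon := \mathrm{diag}(\omega_1, \omega_1\omega_2, \omega_2\omega_3, \dots, \omega_{n-1}\omega_n) \in \mathbb{F}_q^{n\times n}$, where $\omega_k \in \{1,-1\}\subset\mathbb{F}_q$ is $1$ if $\epsilon_k=1$ and $-1$ if $\epsilon_k=-1$; it lies in $LPM_n^{\mathbb{F}_q}(\epsilon)$. Cholesky factorization: over a definite field, for each $A \in LPM_n^{\mathbb{F}_q}(\epsilon)$ there is a unique $L \in \mathbf{L}_n^{\mathbb{F}_q^+}$ with $A = L\,\mathbb{D}_\epsilon L^T$. *)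

theory Defs
  imports "Jordan_Normal_Form.Determinant" "Jordan_Normal_Form.DL_Submatrix"
    "HOL-Library.Cardinality"
begin

text \<open>Every finite field is represented, up to isomorphism, by a type of sort
  \<open>{field, finite}\<close>; \<open>q\<close> is its cardinality.\<close>

definition definite_field :: "'a :: {field, finite} itself \<Rightarrow> bool" where
  "definite_field _ \<longleftrightarrow> CARD('a) mod 4 = 3"

definition positive :: "'a :: field \<Rightarrow> bool" where
  "positive x \<longleftrightarrow> x \<noteq> 0 \<and> (\<exists>y. x = y ^ 2)"

definition quad_char :: "'a :: field \<Rightarrow> int" where
  "quad_char x = (if x = 0 then 0 else if positive x then 1 else -1)"

definition lead_minor :: "'a :: comm_ring_1 mat \<Rightarrow> nat \<Rightarrow> 'a" where
  "lead_minor A k = det (submatrix A {..<k} {..<k})"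

definition symmetric_mats :: "nat \<Rightarrow> 'a mat set" where
  "symmetric_mats n = {A \<in> carrier_mat n n. transpose_mat A = A}"

definition positive_definite :: "nat \<Rightarrow> 'a :: field mat \<Rightarrow> bool" where
  "positive_definite n A \<longleftrightarrow>
     A \<in> symmetric_mats n \<and> (\<forall>k\<in>{1..n}. positive (lead_minor A k))"

definition LPM :: "nat \<Rightarrow> 'a :: field mat set" where
  "LPM n = {A \<in> symmetric_mats n. \<forall>k\<in>{1..n}. lead_minor A k \<noteq> 0}"

text \<open>Sign vectors \<open>\<epsilon> \<in> {1,-1}\<^sup>n\<close> are functions indexed from 1; their values
  outside \<open>{1..n}\<close> play no role.\<close>

definition sign_vectors :: "nat \<Rightarrow> (nat \<Rightarrow> int) set" where
  "sign_vectors n = {1..n} \<rightarrow> {1, -1}"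

definition LPM_sign :: "nat \<Rightarrow> (nat \<Rightarrow> int) \<Rightarrow> 'a :: field mat set" where
  "LPM_sign n \<epsilon> = {A \<in> LPM n. \<forall>k\<in>{1..n}. quad_char (lead_minor A k) = \<epsilon> k}"

definition lower_pos :: "nat \<Rightarrow> 'a :: field mat set" where
  "lower_pos n = {L \<in> carrier_mat n n.
     (\<forall>i<n. \<forall>j<n. i < j \<longrightarrow> L $$ (i,j) = 0) \<and> (\<forall>i<n. positive (L $$ (i,i)))}"

definition sign_elem :: "(nat \<Rightarrow> int) \<Rightarrow> nat \<Rightarrow> 'a :: field" where
  "sign_elem \<epsilon> k = (if \<epsilon> k = 1 then 1 else -1)"

text \<open>Matrix rows are indexed from 0, so row \<open>i\<close> carries the entry
  \<open>\<omega>\<^sub>i \<omega>\<^sub>i\<^sub>+\<^sub>1\<close>, and row 0 carries \<open>\<omega>\<^sub>1\<close>.\<close>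

definition sign_diag :: "nat \<Rightarrow> (nat \<Rightarrow> int) \<Rightarrow> 'a :: field mat" where
  "sign_diag n \<epsilon> = mat_diag n (\<lambda>i. if i = 0 then sign_elem \<epsilon> 1
                                   else sign_elem \<epsilon> i * sign_elem \<epsilon> (i + 1))"

definition minor_signs :: "'a :: field mat \<Rightarrow> nat \<Rightarrow> int" where
  "minor_signs A k = quad_char (lead_minor A k)"

text \<open>\<open>minor_signs A\<close> is the only \<open>\<epsilon>\<close>, up to values outside \<open>{1..n}\<close>, with
  \<open>A \<in> LPM_sign n \<epsilon>\<close>. Over a definite field the factor \<open>L\<close> below exists and is unique
  for every \<open>A \<in> LPM n\<close>, so the definite description is meaningful there.\<close>

lemma LPM_sign_minor_signs: "A \<in> LPM n \<Longrightarrow> A \<in> LPM_sign n (minor_signs A)"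
  by (simp add: LPM_sign_def minor_signs_def)

lemma minor_signs_in_sign_vectors: "A \<in> LPM n \<Longrightarrow> minor_signs A \<in> sign_vectors n"
  by (auto simp: LPM_def minor_signs_def sign_vectors_def quad_char_def)

definition cholesky_factor :: "nat \<Rightarrow> 'a :: field mat \<Rightarrow> 'a mat" where
  "cholesky_factor n A = (THE L. L \<in> lower_pos n \<and>
     A = L * sign_diag n (minor_signs A) * transpose_mat L)"

text \<open>\<open>G\<close> is a group structure on \<open>lower_pos n\<close>, with multiplication \<open>\<circledcirc>\<close>.\<close>

definition LPM_mult :: "nat \<Rightarrow> ('a :: field mat, 'b) monoid_scheme \<Rightarrow> 'a mat \<Rightarrow> 'a mat \<Rightarrow> 'a mat" where
  "LPM_mult n G A B =
     (let M = cholesky_factor n A \<otimes>\<^bsub>G\<^esub> cholesky_factor n B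
      in M * (sign_diag n (minor_signs A) * sign_diag n (minor_signs B)) * transpose_mat M)"

definition LPM_group :: "nat \<Rightarrow> ('a :: field mat, 'b) monoid_scheme \<Rightarrow> 'a mat monoid" where
  "LPM_group n G = \<lparr>carrier = LPM n, mult = LPM_mult n G, one = 1\<^sub>m n\<rparr>"

end

theory Submission
  imports Defs
begin

text \<open>Since \<open>-1\<close> is not a square, every nonzero element is uniquely \<open>\<plusminus>s\<^sup>2\<close> with \<open>s\<close> positive.
  Rescaling the columns of the \<open>LDL\<^sup>T\<close> decomposition therefore turns the diagonal factor into
  signs, which the leading minors determine. Hence
  \<open>(L, \<epsilon>) \<mapsto> L * sign_diag n \<epsilon> * L\<^sup>T\<close> is a bijection from \<open>lower_pos n \<times> {1,-1}\<^sup>n\<close> onto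
  \<open>LPM n\<close>, and it transports the direct product of \<open>\<circledcirc>\<close> with the sign group to
  \<open>LPM_mult n G\<close>. Squares have trivial sign vector, that is, they are positive definite.\<close>

section \<open>Squares in a definite field\<close>

text \<open>Multiplication by \<open>y\<close> permutes the nonzero elements. Comparing their
  product before and after gives the claim, as that product can be cancelled.\<close>

lemma power_card_minus_1_eq_1:
  fixes y :: "'a :: {field, finite}"
  assumes "y \<noteq> 0"
  shows "y ^ (CARD('a) - 1) = 1"
proof -
  let ?S = "UNIV - {0 :: 'a}"
  have "(\<lambda>x. y * x) ` ?S = ?S"
  proof (rule endo_inj_surj)
    show "(\<lambda>x. y * x) ` ?S \<subseteq> ?S" using assms by auto
    show "inj_on (\<lambda>x. y * x) ?S" using assms by (auto simp: inj_on_def)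
  qed simp
  then have "\<Prod>?S = (\<Prod>x\<in>(\<lambda>x. y * x) ` ?S. x)"
    by simp
  also have "\<dots> = (\<Prod>x\<in>?S. y * x)"
    using assms by (subst prod.reindex) (auto simp: inj_on_def)
  also have "\<dots> = y ^ card ?S * \<Prod>?S"
    by (simp add: prod.distrib)
  finally have "y ^ card ?S * \<Prod>?S = 1 * \<Prod>?S"
    by simp
  moreover have "\<Prod>?S \<noteq> 0"
    by (simp add: prod_zero_iff)
  ultimately have "y ^ card ?S = 1"
    by (metis mult_right_cancel)
  then show ?thesis
    by (simp add: card_Diff_singleton)
qed

text \<open>Translation by 1 permutes the field, so adding 1 to each of the \<open>CARD('a)\<close>
  summands leaves the sum of all elements unchanged.\<close>

lemma of_nat_card_UNIV_eq_0: "of_nat (CARD('a :: {field, finite})) = (0 :: 'a)"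
proof -
  have "(\<Sum>x\<in>UNIV. x :: 'a) = (\<Sum>x\<in>range (\<lambda>x. x + 1). x)"
    by (simp add: surj_plus_right)
  also have "\<dots> = (\<Sum>x\<in>UNIV. x + 1)"
    by (subst sum.reindex) (auto simp: inj_on_def)
  also have "\<dots> = (\<Sum>x\<in>UNIV. x) + of_nat (CARD('a))"
    by (simp add: sum.distrib)
  finally show ?thesis
    by simp
qed

text \<open>The cardinality is odd, so 1 = -1 would make its image in the field equal to 1, whereas
  that image is 0.\<close>

lemma definite_field_one_neq_minus_one:
  assumes "definite_field TYPE('a :: {field, finite})"
  shows "(1 :: 'a) \<noteq> - 1"
proof
  assume eq: "(1 :: 'a) = - 1"
  then have two: "(2 :: 'a) = 0"
    by (metis add.right_inverse one_add_one)
  have "CARD('a) = 2 * (CARD('a) div 2) + 1"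
    using assms unfolding definite_field_def by presburger
  then obtain m where "CARD('a) = 2 * m + 1" ..
  then have "of_nat (CARD('a)) = (1 :: 'a)"
    by (simp add: two)
  then show False
    by (simp add: of_nat_card_UNIV_eq_0)
qed

lemma not_positive_minus_one:
  assumes "definite_field TYPE('a :: {field, finite})"
  shows "\<not> positive (- 1 :: 'a)"
proof
  assume "positive (- 1 :: 'a)"
  then obtain y :: 'a where y: "y ^ 2 = - 1"
    unfolding positive_def by metis
  then have "y \<noteq> 0"
    by auto
  \<comment> \<open>Residue 3 modulo 4 makes half of \<open>CARD('a) - 1\<close> odd, so a square
    root of -1 would force 1 = -1.\<close>
  have "CARD('a) - 1 = 2 * (2 * (CARD('a) div 4) + 1)"
    using assms unfolding definite_field_def by presburger
  then have "1 = (y ^ 2) ^ (2 * (CARD('a) div 4) + 1)"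
    using power_card_minus_1_eq_1[OF \<open>y \<noteq> 0\<close>] by (simp only: power_mult)
  also have "\<dots> = - 1"
    unfolding y by simp
  finally show False
    using definite_field_one_neq_minus_one[OF assms] by simp
qed

section \<open>Positive elements and their square roots\<close>

lemma positive_1: "positive 1"
  unfolding positive_def by (metis one_neq_zero power_one)

lemma positive_square: "x \<noteq> 0 \<Longrightarrow> positive (x ^ 2)"
  unfolding positive_def by auto

lemma positive_divide: "positive x \<Longrightarrow> positive y \<Longrightarrow> positive (x / y)"
  unfolding positive_def by (metis divide_eq_0_iff power_divide)

text \<open>Distinct roots of the same square are opposite, and then their quotient -1 would be
  positive.\<close>

lemma positive_power2_inject:
  fixes x y :: "'a :: {field, finite}"
  assumes "definite_field TYPE('a)" "positive x" "positive y" "x ^ 2 = y ^ 2"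
  shows "x = y"
proof (rule ccontr)
  assume "x \<noteq> y"
  then have "x = - y"
    using assms(4) by (simp add: power2_eq_iff)
  then have "x / y = - 1"
    using assms(3) by (simp add: positive_def)
  then show False
    using positive_divide[OF assms(2,3)] not_positive_minus_one[OF assms(1)] by simp
qed

text \<open>Squaring is injective on the finite set of positive elements, hence surjective onto it.\<close>

lemma square_eq_positive_square:
  fixes x :: "'a :: {field, finite}"
  assumes "definite_field TYPE('a)" "positive x"
  shows "\<exists>s. positive s \<and> x = s ^ 2"
proof -
  have "(\<lambda>s :: 'a. s ^ 2) ` Collect positive = Collect positive"
  proof (rule endo_inj_surj)
    show "inj_on (\<lambda>s :: 'a. s ^ 2) (Collect positive)"
      using positive_power2_inject[OF assms(1)] by (auto simp: inj_on_def)
  qed (auto intro: positive_square simp: positive_def)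
  then show ?thesis
    using assms(2) by blast
qed

text \<open>The square \<open>x ^ 2\<close> has a positive root \<open>t\<close>, so
  \<open>x\<close> is \<open>t\<close> or \<open>-t\<close>, and \<open>t\<close> is in turn the
  square of a positive element.\<close>

lemma signed_positive_square:
  fixes x :: "'a :: {field, finite}"
  assumes "definite_field TYPE('a)" "x \<noteq> 0"
  shows "\<exists>s c. positive s \<and> (c = 1 \<or> c = - 1) \<and> x = c * s ^ 2"
proof -
  obtain t where t: "positive t" "x ^ 2 = t ^ 2"
    using square_eq_positive_square[OF assms(1) positive_square[OF assms(2)]] by blast
  then have "x = 1 * t \<or> x = - 1 * t"
    by (simp add: power2_eq_iff)
  moreover obtain s where "positive s" "t = s ^ 2"
    using square_eq_positive_square[OF assms(1) t(1)] by blast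
  ultimately show ?thesis
    by blast
qed

lemma quad_char_square_mult_sign:
  fixes s :: "'a :: {field, finite}"
  assumes "definite_field TYPE('a)" "s \<noteq> 0" "e = 1 \<or> e = - 1"
  shows "quad_char (s ^ 2 * (if e = 1 then 1 else - 1)) = e"
proof (cases "e = 1")
  case True
  then show ?thesis
    using assms positive_square[of s] by (simp add: quad_char_def)
next
  case False
  \<comment> \<open>Otherwise division by \<open>s ^ 2\<close> would make -1 positive.\<close>
  have "\<not> positive (- (s ^ 2))"
    using positive_divide[of "- (s ^ 2)" "s ^ 2"] positive_square[OF assms(2)]
      not_positive_minus_one[OF assms(1)] assms(2) by auto
  then show ?thesis
    using False assms by (simp add: quad_char_def)
qed

section \<open>Triangular factorizations\<close>

lemma congruence_mat_diag_index:
  fixes L :: "'a :: comm_ring_1 mat"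
  assumes "L \<in> carrier_mat n n" "i < n" "j < n"
  shows "(L * mat_diag n d * transpose_mat L) $$ (i, j) = (\<Sum>m<n. L $$ (i, m) * d m * L $$ (j, m))"
proof -
  have "(L * mat_diag n d * transpose_mat L) $$ (i, j) =
      row (L * mat_diag n d) i \<bullet> col (transpose_mat L) j"
    using assms by (intro index_mult_mat(1)) auto
  also have "\<dots> = (\<Sum>m<n. row (L * mat_diag n d) i $ m * col (transpose_mat L) j $ m)"
    using assms(1) by (simp add: scalar_prod_def lessThan_atLeast0)
  also have "\<dots> = (\<Sum>m<n. L $$ (i, m) * d m * L $$ (j, m))"
    using assms by (intro sum.cong refl) (simp add: mat_diag_mult_right[OF assms(1)])
  finally show ?thesis .
qed

lemma lead_minor_eq_det_mat:
  fixes A :: "'a :: comm_ring_1 mat"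
  assumes "A \<in> carrier_mat n n" "k \<le> n"
  shows "lead_minor A k = det (Matrix.mat k k (\<lambda>(i, j). A $$ (i, j)))"
proof -
  \<comment> \<open>In an initial segment the \<open>i\<close>-th smallest element, counted from 0,
    is \<open>i\<close> itself.\<close>
  have pick: "pick {..<k} i = i" if "i < k" for i
    using that
  proof (induction i)
    case 0
    then show ?case by (auto intro!: Least_equality)
  next
    case (Suc i)
    then show ?case by (auto intro!: Least_equality)
  qed
  have "{i. i < n \<and> i \<in> {..<k}} = {..<k}"
    using assms(2) by auto
  then have "submatrix A {..<k} {..<k} =
      Matrix.mat k k (\<lambda>(i, j). A $$ (pick {..<k} i, pick {..<k} j))"
    using assms(1) by (simp only: submatrix_def carrier_matD card_lessThan)
  also have "\<dots> = Matrix.mat k k (\<lambda>(i, j). A $$ (i, j))"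
    by (rule cong_mat) (simp_all only: pick prod.case)
  finally show ?thesis
    unfolding lead_minor_def by (rule arg_cong)
qed

text \<open>The leading block itself factors as triangular, diagonal, transposed triangular, and
  determinants multiply. Taking \<open>l\<close> and \<open>d\<close> as functions covers both
  partial decompositions and actual matrices.\<close>

lemma lead_minor_triangular_factorization:
  fixes A :: "'a :: field mat"
  assumes A: "A \<in> carrier_mat n n" and k: "k \<le> n"
    and l: "\<And>i j. i < j \<Longrightarrow> j < k \<Longrightarrow> l i j = 0"
    and fact: "\<And>i j. i < k \<Longrightarrow> j < k \<Longrightarrow> A $$ (i, j) = (\<Sum>m<k. l i m * d m * l j m)"
  shows "lead_minor A k = (\<Prod>i<k. l i i) ^ 2 * (\<Prod>i<k. d i)"
proof -
  let ?L = "Matrix.mat k k (\<lambda>(i, j). l i j)"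
  have L: "?L \<in> carrier_mat k k"
    by simp
  have "Matrix.mat k k (\<lambda>(i, j). A $$ (i, j)) = ?L * mat_diag k d * transpose_mat ?L"
    using fact by (intro eq_matI) (auto simp: congruence_mat_diag_index[OF L] simp del: index_mult_mat(1))
  moreover have "det ?L = (\<Prod>i<k. l i i)"
    using l by (subst det_lower_triangular[of k]) (auto simp: prod_list_diag_prod lessThan_atLeast0)
  moreover have "det (mat_diag k d) = (\<Prod>i<k. d i)"
    by (subst det_lower_triangular[of k])
      (auto simp: prod_list_diag_prod lessThan_atLeast0 mat_diag_def)
  moreover have "det (?L * mat_diag k d * transpose_mat ?L) = det ?L * det (mat_diag k d) * det ?L"
    using det_mult[OF mult_carrier_mat[OF L mat_diag_dim] transpose_carrier_mat[THEN iffD2, OF L]]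
      det_mult[OF L mat_diag_dim] det_transpose[OF L] by metis
  ultimately show ?thesis
    unfolding lead_minor_eq_det_mat[OF A k] by (simp add: power2_eq_square mult_ac)
qed

section \<open>Existence and uniqueness of the triangular factor\<close>

text \<open>Forward substitution: since \<open>l j k = 0\<close> for \<open>j < k\<close>, a new
  unknown \<open>w k\<close> leaves the earlier equations intact and is solved from its own.\<close>

lemma lower_unitriangular_solvable:
  fixes l :: "nat \<Rightarrow> nat \<Rightarrow> 'a :: field"
  assumes "\<And>i. l i i = 1" "\<And>i j. i < j \<Longrightarrow> l i j = 0" "\<And>i. i < k \<Longrightarrow> d i \<noteq> 0"
  shows "\<exists>w. \<forall>j<k. (\<Sum>m<k. w m * d m * l j m) = b j"
  using assms(3)
proof (induction k)
  case 0
  then show ?case by simp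
next
  case (Suc k)
  then obtain w where w: "\<forall>j<k. (\<Sum>m<k. w m * d m * l j m) = b j"
    by auto
  define w' where "w' = w(k := (b k - (\<Sum>m<k. w m * d m * l k m)) / d k)"
  have "(\<Sum>m<Suc k. w' m * d m * l j m) = b j" if "j < Suc k" for j
    using that w Suc.prems[of k] assms(1)[of k] assms(2)[of j k]
    by (cases "j = k") (auto simp: w'_def)
  then show ?case
    by blast
qed

text \<open>The leading block grows by one row at a time. Forward substitution yields the new row,
  and the new pivot is nonzero because the leading minor is a square times the product of the
  pivots.\<close>

lemma LDL_decomposition:
  fixes A :: "'a :: field mat"
  assumes "A \<in> LPM n" "k \<le> n"
  shows "\<exists>l d. (\<forall>i. l i i = 1) \<and> (\<forall>i j. i < j \<longrightarrow> l i j = 0) \<and> (\<forall>i<k. d i \<noteq> 0) \<and>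
    (\<forall>i<k. \<forall>j<k. A $$ (i, j) = (\<Sum>m<k. l i m * d m * l j m))"
  using assms(2)
proof (induction k)
  case 0
  show ?case
    by (rule exI[of _ "\<lambda>i j. if i = j then 1 else 0"]) auto
next
  case (Suc k)
  obtain l d where l: "\<And>i. l i i = 1" "\<And>i j. i < j \<Longrightarrow> l i j = 0"
    and d: "\<And>i. i < k \<Longrightarrow> d i \<noteq> 0"
    and fact: "\<And>i j. i < k \<Longrightarrow> j < k \<Longrightarrow> A $$ (i, j) = (\<Sum>m<k. l i m * d m * l j m)"
    using Suc.IH[OF Suc_leD[OF Suc.prems]] by blast
  obtain w where w: "\<And>j. j < k \<Longrightarrow> (\<Sum>m<k. w m * d m * l j m) = A $$ (k, j)"
    using lower_unitriangular_solvable[of l k d "\<lambda>j. A $$ (k, j)"] l d by blast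
  have A: "A \<in> carrier_mat n n" "transpose_mat A = A"
    using assms(1) by (auto simp: LPM_def symmetric_mats_def)
  have sym: "A $$ (j, k) = A $$ (k, j)" if "j < k" for j
    using A that Suc.prems by (metis Suc_le_lessD carrier_matD index_transpose_mat(1) less_trans)
  \<comment> \<open>Row \<open>k\<close> receives \<open>w\<close> left of the diagonal and keeps
    its 1 and the zeros to the right. The new pivot below is the Schur complement of the corner
    entry.\<close>
  define l' where "l' = (\<lambda>i m. if i = k \<and> m < k then w m else l i m)"
  define d' where "d' = d(k := A $$ (k, k) - (\<Sum>m<k. w m * d m * w m))"
  have l': "\<And>i. l' i i = 1" "\<And>i j. i < j \<Longrightarrow> l' i j = 0"
    using l by (auto simp: l'_def)
  have fact': "A $$ (i, j) = (\<Sum>m<Suc k. l' i m * d' m * l' j m)" if ij: "i < Suc k" "j < Suc k" for i j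
  proof -
    consider "i < k" "j < k" | "i = k" "j < k" | "i < k" "j = k" | "i = k" "j = k"
      using ij by linarith
    then show ?thesis
    proof cases
      \<comment> \<open>The entries above the corner are reduced to those left of it by the symmetry
        of \<open>A\<close>.\<close>
      case 3
      have "(\<Sum>m<k. l i m * d m * w m) = A $$ (k, i)"
        using w[OF \<open>i < k\<close>] by (simp add: mult_ac)
      then show ?thesis
        using 3 l sym by (simp add: l'_def d'_def)
    qed (use l fact w in \<open>simp_all add: l'_def d'_def\<close>)
  qed
  have "lead_minor A (Suc k) \<noteq> 0"
    using assms(1) Suc.prems by (auto simp: LPM_def)
  then have "(\<Prod>i<Suc k. d' i) \<noteq> 0"
    using lead_minor_triangular_factorization[where l = l' and d = d', OF A(1) Suc.prems] l'(2) fact'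
    by auto
  then have "\<forall>i<Suc k. d' i \<noteq> 0"
    by (metis finite_lessThan lessThan_iff prod_zero_iff)
  then show ?case
    using l' fact' by blast
qed

text \<open>Writing each pivot as \<open>c j * s j ^ 2\<close> and scaling column \<open>j\<close>
  of the triangular factor by \<open>s j\<close> leaves only signs on the diagonal.\<close>

lemma Cholesky_diagonal_exists:
  fixes A :: "'a :: {field, finite} mat"
  assumes "definite_field TYPE('a)" "A \<in> LPM n"
  shows "\<exists>L c. L \<in> lower_pos n \<and> (\<forall>i. c i = 1 \<or> c i = - 1) \<and>
    A = L * mat_diag n c * transpose_mat L"
proof -
  obtain l d where l: "\<And>i. l i i = 1" "\<And>i j. i < j \<Longrightarrow> l i j = 0"
    and d: "\<And>i. i < n \<Longrightarrow> d i \<noteq> 0"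
    and fact: "\<And>i j. i < n \<Longrightarrow> j < n \<Longrightarrow> A $$ (i, j) = (\<Sum>m<n. l i m * d m * l j m)"
    using LDL_decomposition[OF assms(2) order.refl] by blast
  \<comment> \<open>Guarding only the equation keeps positivity and sign valid at every index;
    beyond the range, 1 serves as \<open>s\<close>.\<close>
  have "\<forall>i. \<exists>s c. positive s \<and> (c = 1 \<or> c = - 1) \<and> (i < n \<longrightarrow> d i = c * s ^ 2)"
    using signed_positive_square[OF assms(1) d] positive_1 by blast
  then obtain s c where s: "\<And>i. positive (s i)" and c: "\<And>i. c i = 1 \<or> c i = - 1"
    and dsc: "\<And>i. i < n \<Longrightarrow> d i = c i * s i ^ 2"
    by metis
  define L where "L = Matrix.mat n n (\<lambda>(i, j). l i j * s j)"
  have L: "L \<in> carrier_mat n n" "L \<in> lower_pos n"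
    using l s by (auto simp: L_def lower_pos_def)
  have "A = L * mat_diag n c * transpose_mat L"
  proof (rule eq_matI)
    fix i j
    assume "i < dim_row (L * mat_diag n c * transpose_mat L)"
      "j < dim_col (L * mat_diag n c * transpose_mat L)"
    then have ij: "i < n" "j < n"
      using L(1) by auto
    then show "A $$ (i, j) = (L * mat_diag n c * transpose_mat L) $$ (i, j)"
      unfolding congruence_mat_diag_index[OF L(1) ij] fact[OF ij]
      by (intro sum.cong) (auto simp: L_def dsc power2_eq_square)
  qed (use assms(2) L(1) in \<open>auto simp: LPM_def symmetric_mats_def\<close>)
  then show ?thesis
    using L(2) c by blast
qed

text \<open>Columns are determined from left to right. Once the earlier ones agree, the diagonal
  entry is a positive square root, hence unique, and division by it and by \<open>d j\<close>
  determines the rest of the column.\<close>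

lemma lower_pos_factor_unique:
  fixes L K :: "'a :: {field, finite} mat"
  assumes "definite_field TYPE('a)" and L: "L \<in> lower_pos n" and K: "K \<in> lower_pos n"
    and d: "\<And>i. i < n \<Longrightarrow> d i \<noteq> 0"
    and eq: "L * mat_diag n d * transpose_mat L = K * mat_diag n d * transpose_mat K"
  shows "L = K"
proof -
  \<comment> \<open>The sum stops at \<open>j\<close> because row \<open>j\<close> of
    \<open>M\<close> vanishes right of the diagonal; splitting off \<open>m = j\<close> isolates the
    current column.\<close>
  have expand: "(M * mat_diag n d * transpose_mat M) $$ (i, j) =
      (\<Sum>m<j. M $$ (i, m) * d m * M $$ (j, m)) + M $$ (i, j) * d j * M $$ (j, j)"
    if M: "M \<in> lower_pos n" and ij: "i < n" "j < n" for M :: "'a mat" and i j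
  proof -
    have "M \<in> carrier_mat n n"
      using M by (simp add: lower_pos_def)
    then have "(M * mat_diag n d * transpose_mat M) $$ (i, j) =
        (\<Sum>m<n. M $$ (i, m) * d m * M $$ (j, m))"
      using ij by (rule congruence_mat_diag_index)
    also have "\<dots> = (\<Sum>m<Suc j. M $$ (i, m) * d m * M $$ (j, m))"
      using M ij by (intro sum.mono_neutral_right) (auto simp: lower_pos_def)
    finally show ?thesis
      by simp
  qed
  have col: "\<forall>i<n. L $$ (i, j) = K $$ (i, j)" if "j < n" for j
    using that
  proof (induction j rule: less_induct)
    case (less j)
    have LK: "L $$ (i, j) * d j * L $$ (j, j) = K $$ (i, j) * d j * K $$ (j, j)" if "i < n" for i
    proof -
      have "(\<Sum>m<j. L $$ (i, m) * d m * L $$ (j, m)) = (\<Sum>m<j. K $$ (i, m) * d m * K $$ (j, m))"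
        using less that by (intro sum.cong) auto
      then show ?thesis
        using expand[OF L that less.prems] unfolding eq expand[OF K that less.prems]
        by (simp only: add_left_cancel)
    qed
    have pos: "positive (L $$ (j, j))" "positive (K $$ (j, j))"
      using L K less.prems by (auto simp: lower_pos_def)
    have "L $$ (j, j) ^ 2 = K $$ (j, j) ^ 2"
      using LK[OF less.prems] d[OF less.prems] by (simp add: power2_eq_square mult_ac)
    then have "L $$ (j, j) = K $$ (j, j)"
      using positive_power2_inject[OF assms(1) pos] by simp
    then show ?case
      using LK pos d[OF less.prems] by (simp add: positive_def)
  qed
  show ?thesis
    using col L K by (intro eq_matI) (auto simp: lower_pos_def)
qed

section \<open>Sign vectors as a coordinate\<close>

text \<open>Every sign except the last occurs twice and cancels. This explains the consecutive
  products in \<open>sign_diag\<close>: its first \<open>k\<close> entries multiply to the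
  \<open>k\<close>-th sign.\<close>

lemma prod_telescope_signs:
  fixes e :: "nat \<Rightarrow> 'a :: comm_ring_1"
  assumes "\<And>i. e i * e i = 1"
  shows "(\<Prod>i<Suc k. if i = 0 then e 1 else e i * e (i + 1)) = e (Suc k)"
proof (induction k)
  case (Suc k)
  have "e (Suc k) * (e (Suc k) * e (Suc (Suc k))) = e (Suc (Suc k))"
    by (simp add: assms mult.assoc[symmetric])
  with Suc show ?case
    by simp
qed simp

text \<open>The coordinate map of the bijection described above; the group laws are checked on its
  arguments.\<close>

definition signed_gram :: "nat \<Rightarrow> 'a :: field mat \<Rightarrow> (nat \<Rightarrow> int) \<Rightarrow> 'a mat" where
  "signed_gram n L \<epsilon> = L * sign_diag n \<epsilon> * transpose_mat L"

lemma sign_elem_square: "sign_elem \<epsilon> i * sign_elem \<epsilon> i = 1"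
  by (simp add: sign_elem_def)

text \<open>Sign vectors are recovered from leading minors only on \<open>{1..n}\<close>, so the
  diagonal matrices have to be compared from agreement there.\<close>

lemma sign_diag_cong:
  assumes "\<And>k. k \<in> {1..n} \<Longrightarrow> \<epsilon> k = \<epsilon>' k"
  shows "sign_diag n \<epsilon> = (sign_diag n \<epsilon>' :: 'a :: field mat)"
proof -
  have "sign_elem \<epsilon> k = (sign_elem \<epsilon>' k :: 'a)" if "k \<in> {1..n}" for k
    unfolding sign_elem_def assms[OF that] ..
  then show ?thesis
    unfolding sign_diag_def mat_diag_def by (intro eq_matI) simp_all
qed

lemma sign_diag_mult:
  assumes "\<epsilon> \<in> sign_vectors n" "\<epsilon>' \<in> sign_vectors n"
  shows "sign_diag n \<epsilon> * sign_diag n \<epsilon>' =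
    (sign_diag n (\<lambda>k. \<epsilon> k * \<epsilon>' k) :: 'a :: field mat)"
proof -
  \<comment> \<open>\<open>sign_elem\<close> sends every integer other than 1 to -1, so it is
    multiplicative on signs but not on arbitrary integers.\<close>
  have *: "sign_elem \<epsilon> k * sign_elem \<epsilon>' k = (sign_elem (\<lambda>k. \<epsilon> k * \<epsilon>' k) k :: 'a)" if "k \<in> {1..n}" for k
    using assms that unfolding sign_vectors_def sign_elem_def Pi_iff by fastforce
  have **: "(sign_elem \<epsilon> i * sign_elem \<epsilon> (Suc i)) * (sign_elem \<epsilon>' i * sign_elem \<epsilon>' (Suc i))
      = (sign_elem \<epsilon> i * sign_elem \<epsilon>' i :: 'a) * (sign_elem \<epsilon> (Suc i) * sign_elem \<epsilon>' (Suc i))" for i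
    by (simp only: mult_ac)
  show ?thesis
    unfolding sign_diag_def mat_diag_diag unfolding mat_diag_def
    by (intro cong_mat) (auto simp: * **)
qed

lemma sign_diag_1: "(\<And>k. k \<in> {1..n} \<Longrightarrow> \<epsilon> k = 1) \<Longrightarrow> sign_diag n \<epsilon> = 1\<^sub>m n"
  unfolding sign_diag_def by (subst mat_diag_one[symmetric], unfold mat_diag_def, intro cong_mat)
    (auto simp: sign_elem_def)

lemma signed_gram_cong:
  fixes L :: "'a :: field mat"
  assumes "\<And>k. k \<in> {1..n} \<Longrightarrow> \<epsilon> k = \<epsilon>' k"
  shows "signed_gram n L \<epsilon> = signed_gram n L \<epsilon>'"
proof -
  have "sign_diag n \<epsilon> = (sign_diag n \<epsilon>' :: 'a mat)"
    using assms by (rule sign_diag_cong)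
  then show ?thesis
    by (simp add: signed_gram_def)
qed

lemma sign_vectors_mult:
  assumes "\<epsilon> \<in> sign_vectors n" "\<epsilon>' \<in> sign_vectors n"
  shows "(\<lambda>k. \<epsilon> k * \<epsilon>' k) \<in> sign_vectors n"
  unfolding sign_vectors_def
proof (rule Pi_I)
  fix k assume "k \<in> {1..n}"
  then have "\<epsilon> k \<in> {1, - 1}" "\<epsilon>' k \<in> {1, - 1}"
    using assms unfolding sign_vectors_def by (blast dest: Pi_mem)+
  then show "\<epsilon> k * \<epsilon>' k \<in> {1, - 1}"
    by auto
qed

section \<open>Leading minors in coordinates\<close>

text \<open>The first \<open>k\<close> rows of \<open>L\<close> vanish from column \<open>k\<close>
  on, so the leading block of the product is the product of the leading blocks.\<close>

lemma lead_minor_lower_pos_factor: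
  fixes L :: "'a :: field mat"
  assumes "L \<in> lower_pos n" "k \<le> n"
  shows "lead_minor (L * mat_diag n d * transpose_mat L) k =
    (\<Prod>i<k. L $$ (i, i)) ^ 2 * (\<Prod>i<k. d i)"
proof (rule lead_minor_triangular_factorization[where n = n and l = "\<lambda>i j. L $$ (i, j)"])
  have L: "L \<in> carrier_mat n n"
    using assms(1) by (simp add: lower_pos_def)
  then show "L * mat_diag n d * transpose_mat L \<in> carrier_mat n n"
    by (meson mult_carrier_mat transpose_carrier_mat mat_diag_dim)
  fix i j
  assume ij: "i < k" "j < k"
  then have "(L * mat_diag n d * transpose_mat L) $$ (i, j) =
      (\<Sum>m<n. L $$ (i, m) * d m * L $$ (j, m))"
    using assms(2) by (intro congruence_mat_diag_index[OF L]) auto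
  also have "\<dots> = (\<Sum>m<k. L $$ (i, m) * d m * L $$ (j, m))"
    using assms ij by (intro sum.mono_neutral_right) (auto simp: lower_pos_def)
  finally show "(L * mat_diag n d * transpose_mat L) $$ (i, j) =
    (\<Sum>m<k. L $$ (i, m) * d m * L $$ (j, m))" .
qed (use assms in \<open>auto simp: lower_pos_def\<close>)

lemma lower_pos_diag_prod_nonzero:
  "L \<in> lower_pos n \<Longrightarrow> k \<le> n \<Longrightarrow> (\<Prod>i<k. L $$ (i, i)) \<noteq> 0"
  by (auto simp: prod_zero_iff lower_pos_def positive_def)

text \<open>The first \<open>k\<close> diagonal signs telescope, so the minor is a square times a
  single sign.\<close>

lemma lead_minor_signed_gram:
  assumes "L \<in> lower_pos n" "k \<in> {1..n}"
  shows "lead_minor (signed_gram n L \<epsilon>) k = (\<Prod>i<k. L $$ (i, i)) ^ 2 * sign_elem \<epsilon> k"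
proof -
  obtain k' where k': "k = Suc k'"
    using assms(2) by (cases k) auto
  have "signed_gram n L \<epsilon> = L * mat_diag n (\<lambda>i. if i = 0 then sign_elem \<epsilon> 1
      else sign_elem \<epsilon> i * sign_elem \<epsilon> (i + 1)) * transpose_mat L"
    by (simp only: signed_gram_def sign_diag_def)
  moreover have "k \<le> n"
    using assms(2) by simp
  ultimately show ?thesis
    using lead_minor_lower_pos_factor[OF assms(1)]
    by (simp only: k' prod_telescope_signs[of "sign_elem \<epsilon>", OF sign_elem_square])
qed

lemma signed_gram_in_LPM:
  fixes L :: "'a :: field mat"
  assumes "L \<in> lower_pos n"
  shows "signed_gram n L \<epsilon> \<in> LPM n"
proof -
  have L: "L \<in> carrier_mat n n"
    using assms by (simp add: lower_pos_def)
  have "transpose_mat (signed_gram n L \<epsilon>) = signed_gram n L \<epsilon>"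
  proof (rule eq_matI)
    fix i j
    assume "i < dim_row (signed_gram n L \<epsilon>)" "j < dim_col (signed_gram n L \<epsilon>)"
    then have ij: "i < n" "j < n" "j < dim_row (signed_gram n L \<epsilon>)" "i < dim_col (signed_gram n L \<epsilon>)"
      using L by (auto simp: signed_gram_def)
    show "transpose_mat (signed_gram n L \<epsilon>) $$ (i, j) = signed_gram n L \<epsilon> $$ (i, j)"
      unfolding index_transpose_mat(1)[OF ij(4,3)]
      unfolding signed_gram_def sign_diag_def
        congruence_mat_diag_index[OF L ij(1,2)] congruence_mat_diag_index[OF L ij(2,1)]
      by (simp only: mult_ac)
  qed (use L in \<open>auto simp: signed_gram_def\<close>)
  moreover have "signed_gram n L \<epsilon> \<in> carrier_mat n n"
    using L by (auto simp: signed_gram_def)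
  moreover have "lead_minor (signed_gram n L \<epsilon>) k \<noteq> 0" if "k \<in> {1..n}" for k
    using lower_pos_diag_prod_nonzero[OF assms, of k] that
    by (simp add: lead_minor_signed_gram[OF assms that] sign_elem_def)
  ultimately show ?thesis
    by (simp add: LPM_def symmetric_mats_def)
qed

text \<open>This recovers the sign coordinate: a nonzero square times a sign has that sign as its
  character, because -1 is not a square.\<close>

lemma minor_signs_signed_gram:
  fixes L :: "'a :: {field, finite} mat"
  assumes "definite_field TYPE('a)" "L \<in> lower_pos n" "\<epsilon> \<in> sign_vectors n" "k \<in> {1..n}"
  shows "minor_signs (signed_gram n L \<epsilon>) k = \<epsilon> k"
proof -
  have "\<epsilon> k = 1 \<or> \<epsilon> k = - 1"
    using assms(3,4) by (auto simp: sign_vectors_def)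
  then show ?thesis
    unfolding minor_signs_def lead_minor_signed_gram[OF assms(2,4)] sign_elem_def
    using lower_pos_diag_prod_nonzero[OF assms(2)] assms(4)
    by (intro quad_char_square_mult_sign[OF assms(1)]) auto
qed

lemma Cholesky_exists:
  fixes A :: "'a :: {field, finite} mat"
  assumes "definite_field TYPE('a)" "A \<in> LPM n"
  shows "\<exists>L\<in>lower_pos n. \<exists>\<epsilon>\<in>sign_vectors n. A = signed_gram n L \<epsilon>"
proof -
  obtain L c where L: "L \<in> lower_pos n" and c: "\<And>i. c i = 1 \<or> c i = - 1"
    and A: "A = L * mat_diag n c * transpose_mat L"
    using Cholesky_diagonal_exists[OF assms] by blast
  \<comment> \<open>Partial products invert the telescoping: \<open>c i\<close> becomes the product
    of the signs at \<open>i\<close> and \<open>i + 1\<close>, the empty product giving sign 1 at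
    index 0.\<close>
  define \<epsilon> :: "nat \<Rightarrow> int" where "\<epsilon> k = (if (\<Prod>i<k. c i) = 1 then 1 else - 1)" for k
  have prod: "(\<Prod>i<k. c i) = 1 \<or> (\<Prod>i<k. c i) = - 1" for k
  proof (induction k)
    case (Suc k)
    then show ?case
      using c[of k] by auto
  qed simp
  have \<epsilon>: "sign_elem \<epsilon> k = (\<Prod>i<k. c i)" for k
    using prod[of k] by (auto simp: sign_elem_def \<epsilon>_def)
  have "(if i = 0 then sign_elem \<epsilon> 1 else sign_elem \<epsilon> i * sign_elem \<epsilon> (i + 1)) = c i" for i
  proof -
    have "sign_elem \<epsilon> i * sign_elem \<epsilon> (i + 1) = (sign_elem \<epsilon> i * sign_elem \<epsilon> i) * c i"
      unfolding \<epsilon> by (simp add: mult_ac)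
    then show ?thesis
      by (simp add: sign_elem_square) (simp add: \<epsilon>)
  qed
  then have "A = signed_gram n L \<epsilon>"
    unfolding A signed_gram_def sign_diag_def by presburger
  moreover have "\<epsilon> \<in> sign_vectors n"
    by (simp add: sign_vectors_def \<epsilon>_def)
  ultimately show ?thesis
    using L by blast
qed

text \<open>Recovering the signs first turns the diagonal in the definite description into
  \<open>sign_diag n \<epsilon>\<close>; uniqueness of the triangular factor then applies.\<close>

lemma cholesky_factor_signed_gram:
  fixes L :: "'a :: {field, finite} mat"
  assumes "definite_field TYPE('a)" "L \<in> lower_pos n" "\<epsilon> \<in> sign_vectors n"
  shows "cholesky_factor n (signed_gram n L \<epsilon>) = L"
proof -
  have diag: "sign_diag n (minor_signs (signed_gram n L \<epsilon>)) = (sign_diag n \<epsilon> :: 'a mat)"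
    using minor_signs_signed_gram[OF assms] by (intro sign_diag_cong) simp
  show ?thesis
    unfolding cholesky_factor_def diag
  proof (rule the_equality)
    show "L \<in> lower_pos n \<and> signed_gram n L \<epsilon> = L * sign_diag n \<epsilon> * transpose_mat L"
      using assms(2) by (simp add: signed_gram_def)
    fix K
    assume K: "K \<in> lower_pos n \<and> signed_gram n L \<epsilon> = K * sign_diag n \<epsilon> * transpose_mat K"
    show "K = L"
    proof (rule lower_pos_factor_unique[OF assms(1) _ assms(2)])
      show "K * mat_diag n (\<lambda>i. if i = 0 then sign_elem \<epsilon> 1 else sign_elem \<epsilon> i * sign_elem \<epsilon> (i + 1)) *
          transpose_mat K =
        L * mat_diag n (\<lambda>i. if i = 0 then sign_elem \<epsilon> 1 else sign_elem \<epsilon> i * sign_elem \<epsilon> (i + 1)) *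
          transpose_mat L"
        using K by (simp only: signed_gram_def sign_diag_def)
    qed (use K in \<open>auto simp: sign_elem_def\<close>)
  qed
qed

section \<open>The group operation in coordinates\<close>

text \<open>The operation is componentwise in coordinates, which reduces the group laws to those of
  \<open>G\<close> and of the multiplication of signs.\<close>

lemma LPM_mult_signed_gram:
  fixes L K :: "'a :: {field, finite} mat"
  assumes def: "definite_field TYPE('a)" and L: "L \<in> lower_pos n" "\<epsilon> \<in> sign_vectors n"
    and K: "K \<in> lower_pos n" "\<epsilon>' \<in> sign_vectors n"
  shows "LPM_mult n G (signed_gram n L \<epsilon>) (signed_gram n K \<epsilon>') =
    signed_gram n (L \<otimes>\<^bsub>G\<^esub> K) (\<lambda>k. \<epsilon> k * \<epsilon>' k)"
proof -
  have "sign_diag n (minor_signs (signed_gram n L \<epsilon>)) = (sign_diag n \<epsilon> :: 'a mat)"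
    "sign_diag n (minor_signs (signed_gram n K \<epsilon>')) = (sign_diag n \<epsilon>' :: 'a mat)"
    using minor_signs_signed_gram[OF def L] minor_signs_signed_gram[OF def K]
    by (auto intro!: sign_diag_cong)
  then show ?thesis
    unfolding LPM_mult_def Let_def cholesky_factor_signed_gram[OF def L]
      cholesky_factor_signed_gram[OF def K]
    by (simp add: sign_diag_mult[OF L(2) K(2)] signed_gram_def)
qed

lemma one_mat_eq_signed_gram: "1\<^sub>m n = signed_gram n (1\<^sub>m n) (\<lambda>_. 1)"
  by (simp add: signed_gram_def sign_diag_1)

lemma sign_vectors_1: "(\<lambda>_. 1) \<in> sign_vectors n"
  by (simp add: sign_vectors_def)

text \<open>Every sign is its own inverse. This serves both for inverses in the new group and for
  the definiteness of squares.\<close>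

lemma signed_gram_sign_square:
  assumes "\<epsilon> \<in> sign_vectors n"
  shows "signed_gram n L (\<lambda>k. \<epsilon> k * \<epsilon> k) = signed_gram n L (\<lambda>_. 1)"
proof (rule signed_gram_cong)
  fix k assume "k \<in> {1..n}"
  then have "\<epsilon> k \<in> {1, - 1}"
    using assms unfolding sign_vectors_def by (blast dest: Pi_mem)
  then show "\<epsilon> k * \<epsilon> k = 1"
    by auto
qed

theorem theorem3:
  fixes n :: nat and G :: "('a :: {field, finite} mat, 'b) monoid_scheme"
  assumes "n \<ge> 1"
    and "definite_field TYPE('a)"
    and "group G" and "carrier G = lower_pos n" and "\<one>\<^bsub>G\<^esub> = 1\<^sub>m n"
  shows "group (LPM_group n G) \<and>
    (\<forall>\<epsilon>\<in>sign_vectors n. \<forall>A\<in>LPM_sign n \<epsilon>. \<forall>L\<in>lower_pos n.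
       A = L * sign_diag n \<epsilon> * transpose_mat L \<longrightarrow>
       inv\<^bsub>LPM_group n G\<^esub> A = inv\<^bsub>G\<^esub> L * sign_diag n \<epsilon> * transpose_mat (inv\<^bsub>G\<^esub> L)) \<and>
    (\<forall>A\<in>LPM n. positive_definite n (A \<otimes>\<^bsub>LPM_group n G\<^esub> A))"
proof -
  interpret G: group G by fact
  note def = assms(2) and one = assms(5)
  have G_mult: "L \<otimes>\<^bsub>G\<^esub> K \<in> lower_pos n" if "L \<in> lower_pos n" "K \<in> lower_pos n" for L K
    using that G.m_closed assms(4) by simp
  have G_inv: "inv\<^bsub>G\<^esub> L \<in> lower_pos n" "inv\<^bsub>G\<^esub> L \<otimes>\<^bsub>G\<^esub> L = 1\<^sub>m n" if "L \<in> lower_pos n" for L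
    using that G.inv_closed[of L] G.l_inv[of L] assms(4) one by simp_all
  have G_one: "(1\<^sub>m n :: 'a mat) \<in> lower_pos n" "\<And>L. L \<in> lower_pos n \<Longrightarrow> 1\<^sub>m n \<otimes>\<^bsub>G\<^esub> L = L"
    using G.one_closed G.l_one assms(4) one by simp_all
  let ?H = "LPM_group n G"
  have H: "carrier ?H = LPM n" "\<one>\<^bsub>?H\<^esub> = 1\<^sub>m n" "mult ?H = LPM_mult n G"
    by (simp_all add: LPM_group_def)
  note mult = LPM_mult_signed_gram[OF def, of _ n, where G = G]
  \<comment> \<open>Only the triangular factor is inverted; \<open>\<epsilon>\<close> stays because
    signs are self-inverse.\<close>
  have H_inv: "signed_gram n (inv\<^bsub>G\<^esub> L) \<epsilon> \<otimes>\<^bsub>?H\<^esub> signed_gram n L \<epsilon> = \<one>\<^bsub>?H\<^esub>"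
    if "L \<in> lower_pos n" "\<epsilon> \<in> sign_vectors n" for L \<epsilon>
    unfolding H(2,3) mult[OF G_inv(1)[OF that(1)] that(2) that] G_inv(2)[OF that(1)]
      signed_gram_sign_square[OF that(2)] by (rule one_mat_eq_signed_gram[symmetric])
  have "group ?H"
  proof (rule groupI)
    fix A B assume "A \<in> carrier ?H" "B \<in> carrier ?H"
    then obtain L \<epsilon> K \<epsilon>' where L: "L \<in> lower_pos n" "\<epsilon> \<in> sign_vectors n" "A = signed_gram n L \<epsilon>"
      and K: "K \<in> lower_pos n" "\<epsilon>' \<in> sign_vectors n" "B = signed_gram n K \<epsilon>'"
      using Cholesky_exists[OF def] unfolding H by metis
    show "A \<otimes>\<^bsub>?H\<^esub> B \<in> carrier ?H"
      unfolding H L(3) K(3) mult[OF L(1,2) K(1,2)]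
      by (rule signed_gram_in_LPM[OF G_mult[OF L(1) K(1)]])
    fix C assume "C \<in> carrier ?H"
    then obtain M \<epsilon>'' where M: "M \<in> lower_pos n" "\<epsilon>'' \<in> sign_vectors n" "C = signed_gram n M \<epsilon>''"
      using Cholesky_exists[OF def] unfolding H by metis
    \<comment> \<open>In coordinates this is associativity in \<open>G\<close> together with
      associativity of integer multiplication.\<close>
    show "A \<otimes>\<^bsub>?H\<^esub> B \<otimes>\<^bsub>?H\<^esub> C = A \<otimes>\<^bsub>?H\<^esub> (B \<otimes>\<^bsub>?H\<^esub> C)"
      using L K M G.m_assoc[of L K M] assms(4)
      by (simp add: H mult G_mult sign_vectors_mult mult.assoc)
  next
    show "\<one>\<^bsub>?H\<^esub> \<in> carrier ?H"
      unfolding H by (subst one_mat_eq_signed_gram) (rule signed_gram_in_LPM[OF G_one(1)])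
  next
    fix A assume "A \<in> carrier ?H"
    then obtain L \<epsilon> where L: "L \<in> lower_pos n" "\<epsilon> \<in> sign_vectors n" "A = signed_gram n L \<epsilon>"
      using Cholesky_exists[OF def] unfolding H by metis
    \<comment> \<open>The identity matrix enters through its coordinates, the unit of
      \<open>G\<close> and the constant sign 1.\<close>
    have "LPM_mult n G (signed_gram n (1\<^sub>m n) (\<lambda>_. 1)) A = A"
      unfolding L(3) mult[OF G_one(1) sign_vectors_1 L(1,2)] by (simp add: G_one(2)[OF L(1)])
    then show "\<one>\<^bsub>?H\<^esub> \<otimes>\<^bsub>?H\<^esub> A = A"
      unfolding H one_mat_eq_signed_gram[symmetric] .
    show "\<exists>B\<in>carrier ?H. B \<otimes>\<^bsub>?H\<^esub> A = \<one>\<^bsub>?H\<^esub>"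
      using H_inv[OF L(1,2)] signed_gram_in_LPM[OF G_inv(1)[OF L(1)]] unfolding L(3) H(1) by blast
  qed
  then interpret H: group ?H .
  \<comment> \<open>In a group a left inverse is the inverse, so \<open>H_inv\<close> gives the
    formula.\<close>
  have "inv\<^bsub>?H\<^esub> A = inv\<^bsub>G\<^esub> L * sign_diag n \<epsilon> * transpose_mat (inv\<^bsub>G\<^esub> L)"
    if "\<epsilon> \<in> sign_vectors n" "L \<in> lower_pos n" "A = L * sign_diag n \<epsilon> * transpose_mat L" for \<epsilon> A L
    using H.inv_equality[OF H_inv[OF that(2,1)]] signed_gram_in_LPM[OF that(2)]
      signed_gram_in_LPM[OF G_inv(1)[OF that(2)]] that(3)
    by (simp add: H(1) signed_gram_def)
  moreover have "positive_definite n (A \<otimes>\<^bsub>?H\<^esub> A)" if A: "A \<in> LPM n" for A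
  proof -
    obtain L \<epsilon> where L: "L \<in> lower_pos n" "\<epsilon> \<in> sign_vectors n" "A = signed_gram n L \<epsilon>"
      using Cholesky_exists[OF def A] by blast
    let ?M = "L \<otimes>\<^bsub>G\<^esub> L"
    have M: "?M \<in> lower_pos n"
      by (rule G_mult[OF L(1) L(1)])
    have "A \<otimes>\<^bsub>?H\<^esub> A = signed_gram n ?M (\<lambda>_. 1)"
      unfolding H(3) L(3) mult[OF L(1,2) L(1,2)] by (rule signed_gram_sign_square[OF L(2)])
    \<comment> \<open>With all signs 1, each leading minor is the square of a nonzero diagonal
      product.\<close>
    moreover have "positive (lead_minor (signed_gram n ?M (\<lambda>_. 1)) k)" if "k \<in> {1..n}" for k
      unfolding lead_minor_signed_gram[OF M that]
      using positive_square[OF lower_pos_diag_prod_nonzero[OF M]] that by (simp add: sign_elem_def)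
    ultimately show ?thesis
      using signed_gram_in_LPM[OF M] by (simp add: positive_definite_def LPM_def)
  qed
  ultimately show ?thesis
    using \<open>group ?H\<close> by blast
qed

end
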